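(* Let $T$ be a tree. The topological space $\mathcal{Y}_T$ is bisequential if and only if $T$ is countable.
   Context: A tree is a partially ordered set $(T,<)$ such that for every $t\in T$ the set $\{s\in T: s<t\}$ is well-ordered by $<$. "Countable" means of cardinality at most $\aleph_0$. A partial function $f:T\to T$ is strictly decreasing if for all comparable elements $s<t$ of the domain of $f$ one has $f(t)<f(s)$ (the domain need not be totally ordered; the empty function is allowed). Define $$\mathcal{Y}_T=\{1_F\in\{0,1\}^{T\times T}: F \text{ is the graph of a strictly decreasing partial function } T\to T\},$$ with the subspace topology inherited from the product topology on $\{0,1\}^{T\times T}$; here $1_F$ is the characteristic function of $F\subset T\times T$. Bisequentiality: a sequence $\{A_n\}_{n\in\omega}$ of non-empty subsets of a topological space $X$ converges to $x\in X$ if for every neighborhood $U$ of $x$ there is $n_0\in\omega$ with $A_n\subset U$ for all $n>n_0$. An ultrafilter $\mathcal{U}\subset\mathcal{P}(X)$ converges to $x$ if every neighborhood of $x$ belongs to $\mathcal{U}$. $X$ is bisequential at $x$ if every ultrafilter on $X$ converging to $x$ contains a decreasing sequence $\{U_n\}_{n\in\omega}$ converging to $x$; $X$ is bisequential if it is bisequential at each of its points. *)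

theory Defs
  imports "HOL-Analysis.Analysis"
begin

text \<open>
  A tree is a carrier \<open>T\<close> with its reflexive partial order \<open>r\<close>; the strict order
  \<open>s < t\<close> is \<open>s \<in> underS r t\<close>, i.e. \<open>s \<noteq> t \<and> (s, t) \<in> r\<close>.
\<close>

definition tree :: "'a set \<Rightarrow> 'a rel \<Rightarrow> bool" where
  "tree T r \<longleftrightarrow> partial_order_on T r \<and>
     (\<forall>t\<in>T. well_order_on (underS r t) (Restr r (underS r t)))"

definition strictly_decreasing :: "'a rel \<Rightarrow> ('a \<rightharpoonup> 'a) \<Rightarrow> bool" where
  "strictly_decreasing r f \<longleftrightarrow>
     (\<forall>s\<in>dom f. \<forall>t\<in>dom f. s \<in> underS r t \<longrightarrow> the (f t) \<in> underS r (the (f s)))"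

definition decreasing_graphs :: "'a set \<Rightarrow> 'a rel \<Rightarrow> ('a \<times> 'a) set set" where
  "decreasing_graphs T r =
     {Map.graph f | f. dom f \<subseteq> T \<and> ran f \<subseteq> T \<and> strictly_decreasing r f}"

text \<open>
  Points of a \<open>product_topology\<close> over \<open>T \<times> T\<close> are extensional functions, so the
  characteristic functions are restricted to \<open>T \<times> T\<close>.
\<close>

definition Y_space :: "'a set \<Rightarrow> 'a rel \<Rightarrow> ('a \<times> 'a \<Rightarrow> nat) topology" where
  "Y_space T r =
     subtopology (product_topology (\<lambda>_. discrete_topology {0, 1}) (T \<times> T))
       {restrict (indicator F) (T \<times> T) | F. F \<in> decreasing_graphs T r}"

definition neighborhood_in :: "'a topology \<Rightarrow> 'a \<Rightarrow> 'a set \<Rightarrow> bool" where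
  "neighborhood_in X x U \<longleftrightarrow> U \<subseteq> topspace X \<and> (\<exists>V. openin X V \<and> x \<in> V \<and> V \<subseteq> U)"

definition sets_converge_in :: "'a topology \<Rightarrow> (nat \<Rightarrow> 'a set) \<Rightarrow> 'a \<Rightarrow> bool" where
  "sets_converge_in X A x \<longleftrightarrow>
     (\<forall>n. A n \<noteq> {} \<and> A n \<subseteq> topspace X) \<and>
     (\<forall>U. neighborhood_in X x U \<longrightarrow> (\<exists>n0. \<forall>n>n0. A n \<subseteq> U))"

definition ultrafilter_on :: "'a set \<Rightarrow> 'a set set \<Rightarrow> bool" where
  "ultrafilter_on S \<U> \<longleftrightarrow>
     \<U> \<subseteq> Pow S \<and> S \<in> \<U> \<and> {} \<notin> \<U> \<and>
     (\<forall>A\<in>\<U>. \<forall>B\<in>\<U>. A \<inter> B \<in> \<U>) \<and>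
     (\<forall>A\<in>\<U>. \<forall>B. A \<subseteq> B \<and> B \<subseteq> S \<longrightarrow> B \<in> \<U>) \<and>
     (\<forall>A. A \<subseteq> S \<longrightarrow> A \<in> \<U> \<or> S - A \<in> \<U>)"

definition ultrafilter_converges_in :: "'a topology \<Rightarrow> 'a set set \<Rightarrow> 'a \<Rightarrow> bool" where
  "ultrafilter_converges_in X \<U> x \<longleftrightarrow> (\<forall>U. neighborhood_in X x U \<longrightarrow> U \<in> \<U>)"

definition bisequential_at :: "'a topology \<Rightarrow> 'a \<Rightarrow> bool" where
  "bisequential_at X x \<longleftrightarrow>
     (\<forall>\<U>. ultrafilter_on (topspace X) \<U> \<and> ultrafilter_converges_in X \<U> x \<longrightarrow>
        (\<exists>U :: nat \<Rightarrow> 'a set. (\<forall>n. U n \<in> \<U>) \<and> decseq U \<and> sets_converge_in X U x))"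

definition bisequential_space :: "'a topology \<Rightarrow> bool" where
  "bisequential_space X \<longleftrightarrow> (\<forall>x\<in>topspace X. bisequential_at X x)"

end

theory Submission
  imports Defs
begin

text \<open>
  For countable \<open>T\<close> the product over \<open>T \<times> T\<close> has countably many coordinates, so every point has
  a countable decreasing base of neighborhoods; these lie in any ultrafilter converging to the
  point (\<open>countable_imp_bisequential\<close>).

  For uncountable \<open>T\<close> bisequentiality fails at the empty function. Call \<open>P \<subseteq> A \<times> A\<close> large if
  uncountably many of its vertical sections are uncountable. Suppose that any finitely many large
  sets are met by the graph of a single decreasing function. Then the sets of graphs that meet a
  given large set, together with the neighborhoods of the empty function, have the finite
  intersection property: removing finitely many pairs keeps a set large, and a part of a decreasing
  graph is again decreasing. An ultrafilter containing all of them converges to the empty function.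
  If members \<open>V n\<close> of it converged there too, every pair \<open>p\<close> would have a bound \<open>c p\<close> beyond which
  no graph in \<open>V n\<close> contains \<open>p\<close>. As \<open>A\<close> is uncountable, some set of pairs with \<open>c p \<le> n\<close> is large,
  and \<open>V (n + 1)\<close> would be disjoint from the graphs meeting it, although both belong to the
  ultrafilter (\<open>fubini_selective_imp_not_bisequential\<close>).

  It remains to find an uncountable \<open>A \<subseteq> T\<close> for which finitely many large sets are always met by one
  decreasing graph (\<open>uncountable_tree_fubini_selective\<close>). If \<open>T\<close> has an uncountable chain, it has
  one with countable initial segments: one chooses the arguments \<open>a\<^sub>1 < \<dots> < a\<^sub>k\<close> upwards, one in
  each large set, and then the values \<open>b\<^sub>k < \<dots> < b\<^sub>1\<close> from the last to the first, each time avoiding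
  only countably many elements. If \<open>T\<close> has no uncountable chain, one can choose pairwise
  incomparable arguments, and then the values are arbitrary.
\<close>

section \<open>Decreasing graphs\<close>

text \<open>
  Sets of pairs are easier to restrict and to enlarge one pair at a time than partial functions;
  all later arguments use this description.
\<close>

lemma decreasing_graphs_iff:
  "F \<in> decreasing_graphs T r \<longleftrightarrow>
     F \<subseteq> T \<times> T \<and>
     (\<forall>s u v. (s, u) \<in> F \<longrightarrow> (s, v) \<in> F \<longrightarrow> u = v) \<and>
     (\<forall>s u t v. (s, u) \<in> F \<longrightarrow> (t, v) \<in> F \<longrightarrow> s \<in> underS r t \<longrightarrow> v \<in> underS r u)"
    (is "?L \<longleftrightarrow> ?R")
proof
  assume ?L
  then obtain f where f: "F = Map.graph f" "dom f \<subseteq> T" "ran f \<subseteq> T" "strictly_decreasing r f"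
    unfolding decreasing_graphs_def by blast
  have "v \<in> underS r u" if "f s = Some u" "f t = Some v" "s \<in> underS r t" for s u t v
    using f(4) that unfolding strictly_decreasing_def by force
  moreover have "F \<subseteq> T \<times> T"
    using f(1-3) by (auto simp: Map.graph_def ran_def)
  ultimately show ?R
    using f(1) by (auto simp: Map.graph_def)
next
  assume R: ?R
  define f where "f s = (if \<exists>u. (s, u) \<in> F then Some (THE u. (s, u) \<in> F) else None)" for s
  have f: "f s = Some u \<longleftrightarrow> (s, u) \<in> F" for s u
  proof
    assume "(s, u) \<in> F"
    then have "(THE u. (s, u) \<in> F) = u"
      using R by (intro the_equality) blast+
    then show "f s = Some u"
      using \<open>(s, u) \<in> F\<close> by (auto simp: f_def)
  next
    assume fs: "f s = Some u"
    then obtain v where v: "(s, v) \<in> F"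
      by (auto simp: f_def split: if_splits)
    then have "(THE u. (s, u) \<in> F) = v"
      using R by (intro the_equality) blast+
    then show "(s, u) \<in> F"
      using v fs by (auto simp: f_def split: if_splits)
  qed
  have "F = Map.graph f"
    by (auto simp: Map.graph_def f)
  moreover have "dom f \<subseteq> T" "ran f \<subseteq> T"
    using R by (auto simp: dom_def ran_def f)
  moreover have "strictly_decreasing r f"
    unfolding strictly_decreasing_def
  proof (intro ballI impI)
    fix s t assume st: "s \<in> dom f" "t \<in> dom f" "s \<in> underS r t"
    then obtain u v where "f s = Some u" "f t = Some v"
      by blast
    then show "the (f t) \<in> underS r (the (f s))"
      using R st(3) f[of s u] f[of t v] by simp
  qed
  ultimately show ?L
    unfolding decreasing_graphs_def by blast
qed

lemma decreasing_graphs_subset: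
  assumes "F \<in> decreasing_graphs T r" "G \<subseteq> F"
  shows "G \<in> decreasing_graphs T r"
  unfolding decreasing_graphs_iff
proof (intro conjI allI impI)
  note F = assms(1)[unfolded decreasing_graphs_iff]
  show "G \<subseteq> T \<times> T"
    using F assms(2) by blast
  show "u = v" if "(s, u) \<in> G" "(s, v) \<in> G" for s u v
    using F that[THEN subsetD[OF assms(2)]] by blast
  show "v \<in> underS r u" if "(s, u) \<in> G" "(t, v) \<in> G" "s \<in> underS r t" for s u t v
    using F that(3) that(1,2)[THEN subsetD[OF assms(2)]] by blast
qed

text \<open>
  The condition that two pairs may occur together, with different arguments, in one decreasing graph.
  Apart from containment in \<open>T \<times> T\<close>, the conditions on a decreasing graph all concern two pairs
  at a time, so a new pair need only be compared with each old one.
\<close>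

definition decreasing_pair :: "'a rel \<Rightarrow> 'a \<times> 'a \<Rightarrow> 'a \<times> 'a \<Rightarrow> bool" where
  "decreasing_pair r p q \<longleftrightarrow> fst p \<noteq> fst q \<and>
     (fst p \<in> underS r (fst q) \<longrightarrow> snd q \<in> underS r (snd p)) \<and>
     (fst q \<in> underS r (fst p) \<longrightarrow> snd p \<in> underS r (snd q))"

lemma decreasing_graphs_insert:
  assumes F: "F \<in> decreasing_graphs T r" and p: "p \<in> T \<times> T"
    and pq: "\<And>q. q \<in> F \<Longrightarrow> decreasing_pair r p q"
  shows "insert p F \<in> decreasing_graphs T r"
  unfolding decreasing_graphs_iff
proof (intro conjI allI impI)
  note F' = F[unfolded decreasing_graphs_iff]
  show "insert p F \<subseteq> T \<times> T"
    using F' p by blast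
  show "u = v" if su: "(s, u) \<in> insert p F" "(s, v) \<in> insert p F" for s u v
  proof (cases "(s, u) = p \<or> (s, v) = p")
    case True
    then show ?thesis
      using su pq[of "(s, u)"] pq[of "(s, v)"] by (auto simp: decreasing_pair_def)
  next
    case False
    then show ?thesis
      using F' su by blast
  qed
  show "v \<in> underS r u"
    if su: "(s, u) \<in> insert p F" "(t, v) \<in> insert p F" and st: "s \<in> underS r t" for s u t v
  proof (cases "(s, u) = p \<or> (t, v) = p")
    case True
    have "s \<noteq> t"
      using st by (auto simp: underS_def)
    then show ?thesis
      using True su st pq[of "(s, u)"] pq[of "(t, v)"] by (auto simp: decreasing_pair_def)
  next
    case False
    then show ?thesis
      using F' su st by blast
  qed
qed

section \<open>Fubini-large sets of pairs\<close>

text \<open>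
  Largeness is iterated, rather than plain uncountability in the product, so that an argument can
  be fixed first, with uncountably many values still available for it.
\<close>

definition fubini_large :: "'a set \<Rightarrow> ('a \<times> 'a) set \<Rightarrow> bool" where
  "fubini_large A P \<longleftrightarrow> uncountable {a \<in> A. uncountable {b \<in> A. (a, b) \<in> P}}"

lemma uncountable_mono: "uncountable X \<Longrightarrow> X \<subseteq> Y \<Longrightarrow> uncountable Y"
  using countable_subset[of X Y] by blast

text \<open>
  Each section loses at most countably many points, so an uncountable section stays uncountable.
\<close>

lemma fubini_large_minus_countable:
  assumes P: "fubini_large A P" and E: "countable E"
  shows "fubini_large A (P - E)"
proof -
  have "uncountable {b \<in> A. (a, b) \<in> P - E}" if "uncountable {b \<in> A. (a, b) \<in> P}" for a
  proof -
    have "uncountable ({b \<in> A. (a, b) \<in> P} - snd ` E)"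
      using that E by (simp add: uncountable_minus_countable)
    then show ?thesis
      by (rule uncountable_mono) force
  qed
  then show ?thesis
    using P unfolding fubini_large_def by (elim uncountable_mono) blast
qed

text \<open>
  An uncountable set is not a countable union of countable sets. Applied to each vertical section
  this gives a bound depending on the section, and applied to \<open>A\<close> it makes the bound uniform on
  uncountably many sections.
\<close>

lemma fubini_large_sublevel:
  fixes c :: "'a \<times> 'a \<Rightarrow> nat"
  assumes A: "uncountable A"
  shows "\<exists>n. fubini_large A {p \<in> A \<times> A. c p \<le> n}"
proof -
  have "\<exists>n. uncountable {b \<in> A. c (a, b) \<le> n}" for a
  proof (rule ccontr)
    assume "\<nexists>n. uncountable {b \<in> A. c (a, b) \<le> n}"
    then have "countable (\<Union>n. {b \<in> A. c (a, b) \<le> n})"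
      by blast
    moreover have "A = (\<Union>n. {b \<in> A. c (a, b) \<le> n})"
      by auto
    ultimately show False
      using A by simp
  qed
  then obtain m where m: "\<And>a. uncountable {b \<in> A. c (a, b) \<le> m a}"
    by metis
  have "\<exists>n. uncountable {a \<in> A. m a \<le> n}"
  proof (rule ccontr)
    assume "\<nexists>n. uncountable {a \<in> A. m a \<le> n}"
    then have "countable (\<Union>n. {a \<in> A. m a \<le> n})"
      by blast
    moreover have "A = (\<Union>n. {a \<in> A. m a \<le> n})"
      by auto
    ultimately show False
      using A by simp
  qed
  then obtain n where n: "uncountable {a \<in> A. m a \<le> n}" ..
  have "uncountable {b \<in> A. (a, b) \<in> {p \<in> A \<times> A. c p \<le> n}}" if "a \<in> A" "m a \<le> n" for a
    using m[of a] by (rule uncountable_mono) (use that in auto)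
  then have "fubini_large A {p \<in> A \<times> A. c p \<le> n}"
    unfolding fubini_large_def using n by (elim uncountable_mono) blast
  then show ?thesis ..
qed

text \<open>
  The combinatorial property that defeats bisequentiality: it is the finite intersection property
  for the families of graphs that meet a given large set.
\<close>

definition fubini_selective :: "'a set \<Rightarrow> 'a rel \<Rightarrow> 'a set \<Rightarrow> bool" where
  "fubini_selective T r A \<longleftrightarrow>
     (\<forall>\<P>. finite \<P> \<longrightarrow> (\<forall>P\<in>\<P>. fubini_large A P) \<longrightarrow>
        (\<exists>F\<in>decreasing_graphs T r. \<forall>P\<in>\<P>. F \<inter> P \<noteq> {}))"

text \<open>
  Here \<open>G a\<close> is the set of arguments allowed once \<open>a\<close> has been used. By the first condition on
  \<open>G\<close>, all but countably many \<open>a\<close> leave uncountably many allowed arguments in a given uncountable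
  set, so some argument \<open>a\<close> for one of the large sets keeps all the others large after restriction
  to \<open>G a\<close>. These are treated by induction; the value at \<open>a\<close> is chosen last, when the
  finitely many other pairs are known, and by the last assumption each of them excludes only
  countably many values. Thus arguments are fixed from the first to the last and values from the
  last to the first.
\<close>

lemma fubini_selectiveI:
  fixes T :: "'a set"
  assumes AT: "A \<subseteq> T"
    and G: "\<And>B. B \<subseteq> A \<Longrightarrow> uncountable B \<Longrightarrow> countable {a \<in> A. countable (B \<inter> G a)}"
    and pair: "\<And>a x y. a \<in> A \<Longrightarrow> x \<in> A \<inter> G a \<Longrightarrow> y \<in> A \<Longrightarrow>
                 countable {b \<in> A. \<not> decreasing_pair r (a, b) (x, y)}"
  shows "fubini_selective T r A"
proof -
  have "\<exists>F. finite F \<and> F \<subseteq> A \<times> A \<and> F \<in> decreasing_graphs T r \<and> (\<forall>i\<in>I. F \<inter> P i \<noteq> {})"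
    if "finite I" "\<forall>i\<in>I. fubini_large A (P i)" for I :: "('a \<times> 'a) set set" and P
    using that
  proof (induction I arbitrary: P rule: finite_induct)
    case empty
    have "{} \<in> decreasing_graphs T r"
      by (simp add: decreasing_graphs_iff)
    then show ?case by blast
  next
    case (insert k I)
    define D where "D i = {a \<in> A. uncountable {b \<in> A. (a, b) \<in> P i}}" for i
    have D: "D i \<subseteq> A" "uncountable (D i)" if "i \<in> insert k I" for i
      using insert.prems that by (auto simp: D_def fubini_large_def)
    have "countable (\<Union>i\<in>I. {a \<in> A. countable (D i \<inter> G a)})"
      using G D by (intro countable_UN[OF countable_finite[OF insert.hyps(1)]]) auto
    then have "\<not> D k \<subseteq> (\<Union>i\<in>I. {a \<in> A. countable (D i \<inter> G a)})"
      using D(2)[of k] countable_subset by blast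
    then obtain a where a: "a \<in> D k" "\<And>i. i \<in> I \<Longrightarrow> uncountable (D i \<inter> G a)"
      using D(1)[of k] by blast
    have aA: "a \<in> A"
      using a(1) by (simp add: D_def)
    define Q where "Q i = P i \<inter> (G a \<times> UNIV)" for i
    have "\<forall>i\<in>I. fubini_large A (Q i)"
    proof
      fix i assume i: "i \<in> I"
      have "{b \<in> A. (x, b) \<in> Q i} = {b \<in> A. (x, b) \<in> P i}" if "x \<in> G a" for x
        using that by (auto simp: Q_def)
      then have "D i \<inter> G a \<subseteq> {x \<in> A. uncountable {b \<in> A. (x, b) \<in> Q i}}"
        by (auto simp: D_def)
      then show "fubini_large A (Q i)"
        unfolding fubini_large_def by (rule uncountable_mono[OF a(2)[OF i]])
    qed
    from insert.IH[OF this] obtain F where F: "finite F" "F \<subseteq> A \<times> A"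
        "F \<in> decreasing_graphs T r" "\<forall>i\<in>I. F \<inter> Q i \<noteq> {}"
      by (elim exE conjE)
    \<comment> \<open>The induction may also put pairs with arguments outside \<open>G a\<close> into \<open>F\<close>; the sets \<open>P i\<close> are
      already met inside \<open>G a\<close>, and \<open>decreasing_pair\<close> can be ensured only there.\<close>
    define F' where "F' = F \<inter> (G a \<times> UNIV)"
    have F': "finite F'" "F' \<subseteq> A \<times> A" "F' \<in> decreasing_graphs T r"
      using F(1,2) decreasing_graphs_subset[OF F(3), of F'] by (auto simp: F'_def)
    have F'P: "\<forall>i\<in>I. F' \<inter> P i \<noteq> {}"
      using F(4) unfolding F'_def Q_def by (simp add: Int_ac)
    have "countable {b \<in> A. \<not> decreasing_pair r (a, b) q}" if q: "q \<in> F'" for q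
    proof -
      have "fst q \<in> A \<inter> G a" "snd q \<in> A"
        using q F'(2) by (auto simp: F'_def)
      from pair[OF aA this] show ?thesis by simp
    qed
    then have "countable (\<Union>q\<in>F'. {b \<in> A. \<not> decreasing_pair r (a, b) q})"
      by (intro countable_UN[OF countable_finite[OF F'(1)]])
    moreover have "uncountable {b \<in> A. (a, b) \<in> P k}"
      using a(1) by (simp add: D_def)
    ultimately have "\<not> {b \<in> A. (a, b) \<in> P k} \<subseteq> (\<Union>q\<in>F'. {b \<in> A. \<not> decreasing_pair r (a, b) q})"
      using countable_subset by blast
    then obtain b where b: "b \<in> A" "(a, b) \<in> P k" "\<And>q. q \<in> F' \<Longrightarrow> decreasing_pair r (a, b) q"
      by blast
    have "insert (a, b) F' \<in> decreasing_graphs T r"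
      using F'(3) b aA AT by (intro decreasing_graphs_insert) auto
    then show ?case
      using F'(1,2) F'P b(1,2) aA by (intro exI[of _ "insert (a, b) F'"]) auto
  qed
  note select = this
  show ?thesis
    unfolding fubini_selective_def
  proof (intro allI impI)
    fix \<P> assume "finite \<P>" "\<forall>P\<in>\<P>. fubini_large A P"
    from select[OF this] show "\<exists>F\<in>decreasing_graphs T r. \<forall>P\<in>\<P>. F \<inter> P \<noteq> {}"
      by (elim exE conjE) (rule bexI)
  qed
qed

section \<open>Uncountable trees\<close>

lemma tree_trans: "tree T r \<Longrightarrow> (x, y) \<in> r \<Longrightarrow> (y, z) \<in> r \<Longrightarrow> (x, z) \<in> r"
  using transD[of r x y z] by (simp add: tree_def partial_order_on_def preorder_on_def)

lemma tree_antisym: "tree T r \<Longrightarrow> (x, y) \<in> r \<Longrightarrow> (y, x) \<in> r \<Longrightarrow> x = y"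
  using antisymD[of r x y] by (simp add: tree_def partial_order_on_def)

lemma tree_subset: "tree T r \<Longrightarrow> r \<subseteq> T \<times> T"
  by (simp add: tree_def partial_order_on_def preorder_on_def)

lemma tree_below_comparable:
  assumes "tree T r" "(x, t) \<in> r" "(y, t) \<in> r" "x \<noteq> y"
  shows "(x, y) \<in> r \<or> (y, x) \<in> r"
proof (cases "x = t \<or> y = t")
  case False
  have "t \<in> T"
    using assms tree_subset by fastforce
  then have "total_on (underS r t) (Restr r (underS r t))"
    using assms(1) unfolding tree_def well_order_on_def linear_order_on_def by blast
  then show ?thesis
    using False assms unfolding total_on_def underS_def by blast
qed (use assms in auto)

text \<open>
  After \<open>a\<close> only larger arguments are allowed. Since all but countably many elements of \<open>A\<close> lie
  above a given one, this costs only countably many arguments, and a value above the values already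
  chosen can always be found.
\<close>

lemma chain_fubini_selective:
  assumes tree: "tree T r" and AT: "A \<subseteq> T"
    and chain: "\<And>x y. x \<in> A \<Longrightarrow> y \<in> A \<Longrightarrow> x \<noteq> y \<Longrightarrow> (x, y) \<in> r \<or> (y, x) \<in> r"
    and below: "\<And>a. a \<in> A \<Longrightarrow> countable (underS r a)"
  shows "fubini_selective T r A"
proof (rule fubini_selectiveI[where G = "\<lambda>a. {x. a \<in> underS r x}"])
  have below': "countable {b \<in> A. \<not> a \<in> underS r b}" if "a \<in> A" for a
  proof (rule countable_subset)
    show "{b \<in> A. \<not> a \<in> underS r b} \<subseteq> insert a (underS r a)"
      using chain that by (auto simp: underS_def)
    show "countable (insert a (underS r a))"
      using below[OF that] by simp
  qed
  show "countable {a \<in> A. countable (B \<inter> {x. a \<in> underS r x})}"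
    if B: "B \<subseteq> A" "uncountable B" for B
  proof -
    have "uncountable (B \<inter> {x. a \<in> underS r x})" if "a \<in> A" for a
    proof -
      have "uncountable (B - {b \<in> A. \<not> a \<in> underS r b})"
        using B below'[OF that] by (simp add: uncountable_minus_countable)
      then show ?thesis
        by (rule uncountable_mono) (use B in auto)
    qed
    then have "{a \<in> A. countable (B \<inter> {x. a \<in> underS r x})} = {}"
      by blast
    then show ?thesis by (metis countable_empty)
  qed
  show "countable {b \<in> A. \<not> decreasing_pair r (a, b) (x, y)}"
    if "a \<in> A" "x \<in> A \<inter> {x. a \<in> underS r x}" "y \<in> A" for a x y
  proof (rule countable_subset[OF _ below'[OF \<open>y \<in> A\<close>]])
    have "x \<notin> underS r a" "a \<noteq> x"
      using that tree_antisym[OF tree] by (auto simp: underS_def)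
    then show "{b \<in> A. \<not> decreasing_pair r (a, b) (x, y)} \<subseteq> {b \<in> A. \<not> y \<in> underS r b}"
      by (auto simp: decreasing_pair_def)
  qed
qed (rule AT)

text \<open>
  After \<open>a\<close> only arguments incomparable to \<open>a\<close> are allowed, so there is no condition on values.
  Let \<open>B\<close> be uncountable. The elements \<open>a\<close> to which only countably many elements of \<open>B\<close> are
  incomparable form a chain, so there are countably many such \<open>a\<close>. Indeed, if \<open>a\<close> and \<open>a'\<close> are incomparable, then no element of a tree
  lies above both, so the elements of \<open>B\<close> comparable to both are below \<open>a\<close> or below \<open>a'\<close>. There are
  only countably many of these, so uncountably many elements of \<open>B\<close> are incomparable to \<open>a\<close> or to \<open>a'\<close>.
\<close>

lemma branchless_fubini_selective:
  assumes tree: "tree T r"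
    and below: "\<And>t. t \<in> T \<Longrightarrow> countable (underS r t)"
    and chains: "\<And>C. C \<subseteq> T \<Longrightarrow> (\<And>x y. x \<in> C \<Longrightarrow> y \<in> C \<Longrightarrow> x \<noteq> y \<Longrightarrow> (x, y) \<in> r \<or> (y, x) \<in> r)
                  \<Longrightarrow> countable C"
  shows "fubini_selective T r T"
proof (rule fubini_selectiveI[where G = "\<lambda>a. {x. x \<noteq> a \<and> (a, x) \<notin> r \<and> (x, a) \<notin> r}"])
  fix B assume B: "B \<subseteq> T" "uncountable B"
  show "countable {a \<in> T. countable (B \<inter> {x. x \<noteq> a \<and> (a, x) \<notin> r \<and> (x, a) \<notin> r})}" (is "countable ?D")
  proof (rule chains)
    fix a a' assume a: "a \<in> ?D" "a' \<in> ?D" "a \<noteq> a'"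
    show "(a, a') \<in> r \<or> (a', a) \<in> r"
    proof (rule ccontr)
      assume inc: "\<not> ((a, a') \<in> r \<or> (a', a) \<in> r)"
      have cover: "B \<subseteq> (B \<inter> {x. x \<noteq> a \<and> (a, x) \<notin> r \<and> (x, a) \<notin> r})
              \<union> (B \<inter> {x. x \<noteq> a' \<and> (a', x) \<notin> r \<and> (x, a') \<notin> r})
              \<union> (insert a (underS r a) \<union> insert a' (underS r a'))"
        using inc a(3) tree_below_comparable[OF tree] by (fastforce simp: underS_def)
      have "countable B"
        by (rule countable_subset[OF cover]) (use a below in auto)
      then show False
        using B(2) by contradiction
    qed
  qed blast
next
  fix a x y assume "a \<in> T" "x \<in> T \<inter> {x. x \<noteq> a \<and> (a, x) \<notin> r \<and> (x, a) \<notin> r}" "y \<in> T"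
  then have "{b \<in> T. \<not> decreasing_pair r (a, b) (x, y)} = {}"
    by (auto simp: decreasing_pair_def underS_def)
  then show "countable {b \<in> T. \<not> decreasing_pair r (a, b) (x, y)}"
    by (simp only: countable_empty)
qed simp

text \<open>
  The predecessors of \<open>t\<close> are well-ordered, so a least one with uncountably many predecessors can
  be taken, if there is any; otherwise \<open>t\<close> itself will do. The predecessors of \<open>m\<close> then form an
  uncountable chain with countable initial segments.
\<close>

lemma uncountable_below_imp_chain:
  assumes tree: "tree T r" and t: "t \<in> T" "uncountable (underS r t)"
  shows "\<exists>m\<in>T. uncountable (underS r m) \<and> (\<forall>a\<in>underS r m. countable (underS r a))"
proof (cases "\<forall>a\<in>underS r t. countable (underS r a)")
  case False
  let ?U = "underS r t"
  have wf: "wf (Restr r ?U - Id)"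
    using tree t(1) unfolding tree_def well_order_on_def by blast
  obtain u where u: "u \<in> {a \<in> ?U. uncountable (underS r a)}"
    using False by blast
  from wf[unfolded wf_eq_minimal, rule_format, OF u]
  obtain m where m': "m \<in> {a \<in> ?U. uncountable (underS r a)}"
      and min: "\<forall>a. (a, m) \<in> Restr r ?U - Id \<longrightarrow> a \<notin> {a \<in> ?U. uncountable (underS r a)}"
    by (elim bexE)
  then have m: "m \<in> ?U" "uncountable (underS r m)"
    by simp_all
  have "countable (underS r a)" if a: "a \<in> underS r m" for a
  proof -
    have "a \<in> ?U"
      using a m(1) tree_trans[OF tree, of a m t] tree_antisym[OF tree, of m t] by (auto simp: underS_def)
    then show ?thesis
      using m(1) spec[OF min, of a] a by (auto simp: underS_def)
  qed
  moreover have "m \<in> T"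
    using m(1) tree_subset[OF tree] by (auto simp: underS_def)
  ultimately show ?thesis
    using m(2) by blast
qed (use t in blast)

text \<open>
  If some element has uncountably many predecessors, or if there is an uncountable chain and all
  elements have countably many predecessors, then the chain case applies. Otherwise the incomparable
  case applies to all of \<open>T\<close>.
\<close>

lemma uncountable_tree_fubini_selective:
  assumes tree: "tree T r" and T: "uncountable T"
  shows "\<exists>A. uncountable A \<and> fubini_selective T r A"
proof (cases "\<exists>t\<in>T. uncountable (underS r t)")
  case True
  then obtain m where m: "m \<in> T" "uncountable (underS r m)" "\<forall>a\<in>underS r m. countable (underS r a)"
    using uncountable_below_imp_chain[OF tree] by blast
  have mT: "underS r m \<subseteq> T"
    using tree_subset[OF tree] by (auto simp: underS_def)
  have "fubini_selective T r (underS r m)"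
  proof (rule chain_fubini_selective[OF tree mT])
    show "(x, y) \<in> r \<or> (y, x) \<in> r" if "x \<in> underS r m" "y \<in> underS r m" "x \<noteq> y" for x y
      using that tree_below_comparable[OF tree] by (auto simp: underS_def)
  qed (use m(3) in blast)
  then show ?thesis
    using m(2) mT by blast
next
  case below: False
  show ?thesis
  proof (cases "\<exists>C. C \<subseteq> T \<and> uncountable C \<and>
      (\<forall>x\<in>C. \<forall>y\<in>C. x \<noteq> y \<longrightarrow> (x, y) \<in> r \<or> (y, x) \<in> r)")
    case True
    then obtain C where C: "C \<subseteq> T" "uncountable C"
        "\<And>x y. x \<in> C \<Longrightarrow> y \<in> C \<Longrightarrow> x \<noteq> y \<Longrightarrow> (x, y) \<in> r \<or> (y, x) \<in> r"
      by blast
    have "fubini_selective T r C"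
      using below C(1) by (intro chain_fubini_selective[OF tree C(1) C(3)]) auto
    then show ?thesis
      using C by blast
  next
    case False
    have "fubini_selective T r T"
    proof (rule branchless_fubini_selective[OF tree])
      show "countable (underS r t)" if "t \<in> T" for t
        using below that by blast
      show "countable C" if "C \<subseteq> T"
        "\<And>x y. x \<in> C \<Longrightarrow> y \<in> C \<Longrightarrow> x \<noteq> y \<Longrightarrow> (x, y) \<in> r \<or> (y, x) \<in> r" for C
        using False that by blast
    qed
    then show ?thesis
      using T by blast
  qed
qed

section \<open>The topology of \<open>Y_space\<close>\<close>

text \<open>
  The factors are discrete, so a basic neighborhood prescribes finitely many coordinates.
\<close>

lemma neighborhood_in_Y_space:
  assumes x: "x \<in> topspace (Y_space T r)"
  shows "neighborhood_in (Y_space T r) x U \<longleftrightarrow> U \<subseteq> topspace (Y_space T r) \<and>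
    (\<exists>E. finite E \<and> E \<subseteq> T \<times> T \<and> {g \<in> topspace (Y_space T r). \<forall>e\<in>E. g e = x e} \<subseteq> U)"
    (is "?L \<longleftrightarrow> ?R")
proof
  define Z :: "('a \<times> 'a \<Rightarrow> nat) set" where "Z = {restrict (indicator F) (T \<times> T) | F. F \<in> decreasing_graphs T r}"
  let ?X = "product_topology (\<lambda>_. discrete_topology {0, 1::nat}) (T \<times> T)"
  have Y: "Y_space T r = subtopology ?X Z"
    by (simp add: Y_space_def Z_def)
  have top: "topspace (Y_space T r) = topspace ?X \<inter> Z"
    by (simp add: Y)
  {
    assume ?L
    then obtain V where V: "U \<subseteq> topspace (Y_space T r)" "openin (Y_space T r) V" "x \<in> V" "V \<subseteq> U"
      unfolding neighborhood_in_def by blast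
    then obtain S where S: "openin ?X S" "V = S \<inter> Z"
      unfolding Y openin_subtopology by blast
    then obtain W where W: "finite {i \<in> T \<times> T. W i \<noteq> {0, 1}}" "x \<in> Pi\<^sub>E (T \<times> T) W" "Pi\<^sub>E (T \<times> T) W \<subseteq> S"
      using V(3) unfolding openin_product_topology_alt topspace_discrete_topology by blast
    let ?E = "{i \<in> T \<times> T. W i \<noteq> {0, 1}}"
    have "g \<in> U" if g: "g \<in> topspace (Y_space T r)" "\<forall>e\<in>?E. g e = x e" for g
    proof -
      have gX: "g \<in> (T \<times> T) \<rightarrow>\<^sub>E {0, 1}" "g \<in> Z"
        using g(1) by (simp_all add: top)
      have "g i \<in> W i" if "i \<in> T \<times> T" for i
      proof (cases "i \<in> ?E")
        case True
        then show ?thesis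
          using bspec[OF g(2) True] PiE_mem[OF W(2) that] by metis
      next
        case False
        then have "W i = {0, 1}" using that by blast
        then show ?thesis
          using PiE_mem[OF gX(1) that] by simp
      qed
      then have "g \<in> Pi\<^sub>E (T \<times> T) W"
        using gX(1) by (simp add: PiE_iff)
      then show ?thesis
        using W(3) S(2) gX(2) V(4) by blast
    qed
    then show ?R
      using V(1) W(1) by (intro conjI exI[of _ ?E]) auto
  next
    assume ?R
    then obtain E where E: "U \<subseteq> topspace (Y_space T r)" "finite E" "E \<subseteq> T \<times> T"
        "{g \<in> topspace (Y_space T r). \<forall>e\<in>E. g e = x e} \<subseteq> U"
      by blast
    let ?W = "\<lambda>i. if i \<in> E then {x i} else {0, 1}"
    have x': "x \<in> (T \<times> T) \<rightarrow>\<^sub>E {0, 1}" "x \<in> Z"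
      using x by (simp_all add: top)
    have xE: "x i \<in> {0, 1}" if "i \<in> E" for i
      using PiE_mem[OF x'(1) subsetD[OF E(3) that]] .
    have "openin ?X (Pi\<^sub>E (T \<times> T) ?W)"
      unfolding openin_PiE_gen
    proof (intro disjI2 conjI ballI)
      show "finite {i \<in> T \<times> T. ?W i \<noteq> topspace (discrete_topology {0, 1})}"
        by (rule finite_subset[OF _ E(2)]) auto
      show "openin (discrete_topology {0, 1}) (?W i)" if "i \<in> T \<times> T" for i
        using xE by auto
    qed
    then have "openin (Y_space T r) (Pi\<^sub>E (T \<times> T) ?W \<inter> Z)"
      unfolding Y openin_subtopology by blast
    moreover have "x \<in> Pi\<^sub>E (T \<times> T) ?W \<inter> Z"
      using x' by (auto simp: PiE_iff)
    moreover have "Pi\<^sub>E (T \<times> T) ?W \<inter> Z \<subseteq> U"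
    proof
      fix g assume g: "g \<in> Pi\<^sub>E (T \<times> T) ?W \<inter> Z"
      have "Pi\<^sub>E (T \<times> T) ?W \<subseteq> (T \<times> T) \<rightarrow>\<^sub>E {0, 1}"
        using xE by (intro PiE_mono) auto
      then have "g \<in> (T \<times> T) \<rightarrow>\<^sub>E {0, 1}"
        by (rule subsetD) (rule IntD1[OF g])
      then have "g \<in> topspace (Y_space T r)"
        using IntD2[OF g] by (simp add: top)
      moreover have "\<forall>e\<in>E. g e = x e"
      proof
        fix e assume e: "e \<in> E"
        have "g e \<in> ?W e"
          using PiE_mem[OF IntD1[OF g] subsetD[OF E(3) e]] .
        then show "g e = x e"
          using e by simp
      qed
      ultimately show "g \<in> U"
        using E(4) by blast
    qed
    ultimately show ?L
      using E(1) unfolding neighborhood_in_def by blast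
  }
qed

section \<open>Ultrafilters\<close>

text \<open>
  By Zorn's lemma there is a maximal family with the finite intersection property that contains
  \<open>\<B>\<close>. By maximality it contains every subset of \<open>S\<close> that meets all its finite intersections, which
  yields all the closure properties of an ultrafilter.
\<close>

lemma ultrafilter_on_extends:
  assumes B: "\<B> \<subseteq> Pow S" and fip: "\<And>\<C>. finite \<C> \<Longrightarrow> \<C> \<subseteq> \<B> \<Longrightarrow> S \<inter> \<Inter>\<C> \<noteq> {}"
  shows "\<exists>\<U>. ultrafilter_on S \<U> \<and> \<B> \<subseteq> \<U>"
proof -
  define FIP where "FIP = {\<M>. \<B> \<subseteq> \<M> \<and> \<M> \<subseteq> Pow S \<and>
    (\<forall>\<C>. finite \<C> \<longrightarrow> \<C> \<subseteq> \<M> \<longrightarrow> S \<inter> \<Inter>\<C> \<noteq> {})}"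
  have "\<exists>\<M>\<in>FIP. \<forall>\<N>\<in>FIP. \<M> \<subseteq> \<N> \<longrightarrow> \<N> = \<M>"
  proof (rule subset_Zorn_nonempty)
    have "\<B> \<in> FIP"
      using B fip by (simp add: FIP_def)
    then show "FIP \<noteq> {}"
      by blast
    fix K assume K: "K \<noteq> {}" "subset.chain FIP K"
    have KF: "K \<subseteq> FIP"
      using K(2) by (simp add: subset.chain_def)
    have fip_K: "S \<inter> \<Inter>\<C> \<noteq> {}" if C: "finite \<C>" "\<C> \<subseteq> \<Union>K" for \<C>
    proof -
      obtain \<M> where "\<M> \<in> K" "\<C> \<subseteq> \<M>"
        by (rule finite_subset_Union_chain[OF C K])
      then show ?thesis
        using subsetD[OF KF \<open>\<M> \<in> K\<close>] C(1) by (simp add: FIP_def)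
    qed
    have "\<forall>\<M>\<in>K. \<B> \<subseteq> \<M> \<and> \<M> \<subseteq> Pow S"
      using KF by (auto simp: FIP_def)
    then have "\<B> \<subseteq> \<Union>K" "\<Union>K \<subseteq> Pow S"
      using K(1) by (fast, fast)
    then show "\<Union>K \<in> FIP"
      using fip_K by (simp add: FIP_def)
  qed
  then obtain \<M> where M: "\<M> \<in> FIP" and max: "\<And>\<N>. \<N> \<in> FIP \<Longrightarrow> \<M> \<subseteq> \<N> \<Longrightarrow> \<N> = \<M>"
    by blast
  have MB: "\<B> \<subseteq> \<M>" "\<M> \<subseteq> Pow S"
    and Mfip: "\<And>\<C>. finite \<C> \<Longrightarrow> \<C> \<subseteq> \<M> \<Longrightarrow> S \<inter> \<Inter>\<C> \<noteq> {}"
    using M by (simp_all add: FIP_def)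
  have mem: "A \<in> \<M>" if "A \<subseteq> S" and A: "\<And>\<C>. finite \<C> \<Longrightarrow> \<C> \<subseteq> \<M> \<Longrightarrow> A \<inter> \<Inter>\<C> \<noteq> {}" for A
  proof -
    have fip_A: "S \<inter> \<Inter>\<C> \<noteq> {}" if "finite \<C>" "\<C> \<subseteq> insert A \<M>" for \<C>
    proof -
      have "A \<inter> \<Inter>(\<C> - {A}) \<noteq> {}"
        using that by (intro A) auto
      then show ?thesis
        using \<open>A \<subseteq> S\<close> by blast
    qed
    have "\<B> \<subseteq> insert A \<M>" "insert A \<M> \<subseteq> Pow S"
      using MB \<open>A \<subseteq> S\<close> by blast+
    then have "insert A \<M> \<in> FIP"
      using fip_A by (simp add: FIP_def)
    then show ?thesis
      using max by blast
  qed
  have "ultrafilter_on S \<M>"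
    unfolding ultrafilter_on_def
  proof (intro conjI ballI allI impI)
    show "S \<in> \<M>"
      using Mfip by (intro mem) auto
    show "{} \<notin> \<M>"
      using Mfip[of "{{}}"] by auto
    show "A \<inter> B \<in> \<M>" if "A \<in> \<M>" "B \<in> \<M>" for A B
    proof (rule mem)
      show "(A \<inter> B) \<inter> \<Inter>\<C> \<noteq> {}" if "finite \<C>" "\<C> \<subseteq> \<M>" for \<C>
        using Mfip[of "insert A (insert B \<C>)"] that \<open>A \<in> \<M>\<close> \<open>B \<in> \<M>\<close> by auto
    qed (use that MB in blast)
    show "B \<in> \<M>" if "A \<in> \<M>" "A \<subseteq> B \<and> B \<subseteq> S" for A B
    proof (rule mem)
      show "B \<inter> \<Inter>\<C> \<noteq> {}" if "finite \<C>" "\<C> \<subseteq> \<M>" for \<C>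
        using Mfip[of "insert A \<C>"] that \<open>A \<in> \<M>\<close> \<open>A \<subseteq> B \<and> B \<subseteq> S\<close> by auto
    qed (use that in blast)
    show "A \<in> \<M> \<or> S - A \<in> \<M>" if AS: "A \<subseteq> S" for A
    proof (rule ccontr)
      assume neg: "\<not> (A \<in> \<M> \<or> S - A \<in> \<M>)"
      obtain \<C> where C: "finite \<C>" "\<C> \<subseteq> \<M>" "A \<inter> \<Inter>\<C> = {}"
        using neg mem[OF AS] by blast
      obtain \<D> where D: "finite \<D>" "\<D> \<subseteq> \<M>" "(S - A) \<inter> \<Inter>\<D> = {}"
        using neg mem[of "S - A"] by blast
      have "S \<inter> \<Inter>(\<C> \<union> \<D>) \<noteq> {}"
        using C D by (intro Mfip) auto
      then show False
        using C(3) D(3) by blast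
    qed
  qed (rule MB)
  then show ?thesis
    using MB by blast
qed

lemma ultrafilter_on_finite_Inter:
  assumes "ultrafilter_on S \<U>" "finite \<C>" "\<C> \<subseteq> \<U>"
  shows "S \<inter> \<Inter>\<C> \<in> \<U>"
  using assms(2,3)
proof (induction rule: finite_induct)
  case empty
  then show ?case
    using assms(1) by (simp add: ultrafilter_on_def)
next
  case (insert A \<C>)
  have "S \<inter> \<Inter>(insert A \<C>) = A \<inter> (S \<inter> \<Inter>\<C>)"
    by blast
  then show ?case
    using insert assms(1) unfolding ultrafilter_on_def by (metis insert_subset)
qed

section \<open>Bisequentiality\<close>

text \<open>
  Enumerate the coordinates; the sets \<open>V n\<close> that prescribe the first \<open>n\<close> of them form a decreasing
  neighborhood base of \<open>x\<close>, independent of the ultrafilter.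
\<close>

lemma countable_imp_bisequential:
  assumes T: "countable T"
  shows "bisequential_space (Y_space T r)"
  unfolding bisequential_space_def bisequential_at_def
proof (intro ballI allI impI)
  let ?Y = "topspace (Y_space T r)"
  fix x \<U> assume x: "x \<in> ?Y"
    and U: "ultrafilter_on ?Y \<U> \<and> ultrafilter_converges_in (Y_space T r) \<U> x"
  define k where "k = to_nat_on (T \<times> T)"
  have k: "inj_on k (T \<times> T)"
    unfolding k_def by (intro inj_on_to_nat_on countable_SIGMA T)
  define V where "V n = {g \<in> ?Y. \<forall>e\<in>{e \<in> T \<times> T. k e < n}. g e = x e}" for n
  have "neighborhood_in (Y_space T r) x (V n)" for n
    unfolding neighborhood_in_Y_space[OF x]
  proof (intro conjI exI)
    have "finite (k -` {..<n} \<inter> (T \<times> T))"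
      by (rule finite_vimage_IntI[OF _ k]) simp
    then show "finite {e \<in> T \<times> T. k e < n}"
      by (rule finite_subset[rotated]) auto
  qed (auto simp: V_def)
  then have "V n \<in> \<U>" for n
    using U by (simp add: ultrafilter_converges_in_def)
  moreover have "decseq V"
    unfolding decseq_def V_def by fastforce
  moreover have "sets_converge_in (Y_space T r) V x"
    unfolding sets_converge_in_def
  proof (intro conjI allI impI)
    show "V n \<noteq> {}" "V n \<subseteq> ?Y" for n
      using x by (auto simp: V_def)
    fix W assume "neighborhood_in (Y_space T r) x W"
    then obtain E where E: "finite E" "E \<subseteq> T \<times> T" "{g \<in> ?Y. \<forall>e\<in>E. g e = x e} \<subseteq> W"
      unfolding neighborhood_in_Y_space[OF x] by blast
    have "V n \<subseteq> W" if "n > Max (insert 0 (k ` E))" for n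
    proof -
      have "k e < n" if "e \<in> E" for e
        using \<open>n > _\<close> E(1) that by (meson Max_ge finite_imageI finite_insert imageI insertCI le_less_trans)
      then have "V n \<subseteq> {g \<in> ?Y. \<forall>e\<in>E. g e = x e}"
        using E(2) by (auto simp: V_def)
      then show ?thesis
        using E(3) by blast
    qed
    then show "\<exists>n0. \<forall>n>n0. V n \<subseteq> W" by blast
  qed
  ultimately show "\<exists>U. (\<forall>n. U n \<in> \<U>) \<and> decseq U \<and> sets_converge_in (Y_space T r) U x"
    by blast
qed

text \<open>
  The ultrafilter contains, for every large \<open>P\<close>, the set \<open>hit P\<close> of the graphs that meet \<open>P\<close>, and
  it converges to the empty graph because it contains \<open>avoid e\<close>, the set of the graphs without \<open>e\<close>,
  for every pair \<open>e\<close>. A sequence of members converging to the empty graph eventually avoids each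
  single pair, with a delay \<open>c p\<close> depending on the pair. The delay is bounded on some large set,
  so some member of the sequence avoids this entire large set, which no member of the ultrafilter
  can do.
\<close>

lemma fubini_selective_imp_not_bisequential:
  assumes A: "uncountable A" and sel: "fubini_selective T r A"
  shows "\<not> bisequential_space (Y_space T r)"
proof
  assume bis: "bisequential_space (Y_space T r)"
  let ?Y = "topspace (Y_space T r)"
  define point :: "('a \<times> 'a) set \<Rightarrow> 'a \<times> 'a \<Rightarrow> nat" where "point F = restrict (indicator F) (T \<times> T)" for F
  have Y: "point F \<in> ?Y" if "F \<in> decreasing_graphs T r" for F
  proof -
    have "point F \<in> (T \<times> T) \<rightarrow>\<^sub>E {0, 1}"
      unfolding point_def restrict_PiE_iff by (simp add: indicator_def)
    then show ?thesis
      using that unfolding Y_space_def point_def topspace_subtopology topspace_product_topology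
        topspace_discrete_topology by blast
  qed
  define hit where "hit P = {g \<in> ?Y. \<exists>p\<in>P \<inter> T \<times> T. g p = 1}" for P
  define avoid where "avoid e = {g \<in> ?Y. g e = 0}" for e
  define \<B> where "\<B> = hit ` {P. fubini_large A P} \<union> avoid ` (T \<times> T)"
  have "\<exists>\<U>. ultrafilter_on ?Y \<U> \<and> \<B> \<subseteq> \<U>"
  proof (rule ultrafilter_on_extends)
    show "\<B> \<subseteq> Pow ?Y"
      by (auto simp: \<B>_def hit_def avoid_def)
    fix \<C> assume C: "finite \<C>" "\<C> \<subseteq> \<B>"
    obtain \<P> where P: "finite \<P>" "\<P> \<subseteq> {P. fubini_large A P}" "\<C> \<inter> hit ` {P. fubini_large A P} = hit ` \<P>"
      using finite_subset_image[OF finite_Int[OF disjI1[OF C(1)]] Int_lower2] by metis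
    obtain E where E: "finite E" "E \<subseteq> T \<times> T" "\<C> \<inter> avoid ` (T \<times> T) = avoid ` E"
      using finite_subset_image[OF finite_Int[OF disjI1[OF C(1)]] Int_lower2] by metis
    have "\<C> = \<C> \<inter> hit ` {P. fubini_large A P} \<union> \<C> \<inter> avoid ` (T \<times> T)"
      using C(2) unfolding \<B>_def Int_Un_distrib[symmetric] by (simp add: Int_absorb2)
    then have CPE: "\<C> = hit ` \<P> \<union> avoid ` E"
      unfolding P(3) E(3) .
    \<comment> \<open>A graph meeting all sets \<open>P - E\<close> still meets them after \<open>E\<close> has been removed from it.\<close>
    have "\<forall>P\<in>(\<lambda>P. P - E) ` \<P>. fubini_large A P"
    proof safe
      fix P assume "P \<in> \<P>"
      then have "fubini_large A P"
        using P(2) by auto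
      then show "fubini_large A (P - E)"
        by (rule fubini_large_minus_countable) (rule countable_finite[OF E(1)])
    qed
    from sel[unfolded fubini_selective_def, THEN spec, THEN mp, OF finite_imageI[OF P(1)], THEN mp, OF this]
    obtain F where F: "F \<in> decreasing_graphs T r" "\<forall>P\<in>\<P>. F \<inter> (P - E) \<noteq> {}"
      by auto
    have FE: "F - E \<in> decreasing_graphs T r"
      using F(1) by (rule decreasing_graphs_subset) blast
    then have FET: "F - E \<subseteq> T \<times> T"
      by (simp add: decreasing_graphs_iff)
    have "point (F - E) \<in> hit P" if P_mem: "P \<in> \<P>" for P
    proof -
      obtain p where "p \<in> F - E" "p \<in> P"
        using bspec[OF F(2) P_mem] by auto
      moreover have "p \<in> T \<times> T"
        using FET \<open>p \<in> F - E\<close> by (rule subsetD)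
      ultimately have "p \<in> P \<inter> T \<times> T" "point (F - E) p = 1"
        by (simp_all add: point_def)
      then show ?thesis
        using Y[OF FE] unfolding hit_def by blast
    qed
    moreover have "point (F - E) \<in> avoid e" if "e \<in> E" for e
      using Y[OF FE] that subsetD[OF E(2) that] by (simp add: avoid_def point_def)
    ultimately have "point (F - E) \<in> ?Y \<inter> \<Inter>\<C>"
      using Y[OF FE] unfolding CPE by (simp add: ball_Un)
    then show "?Y \<inter> \<Inter>\<C> \<noteq> {}" by blast
  qed
  then obtain \<U> where U: "ultrafilter_on ?Y \<U>" "\<B> \<subseteq> \<U>" by blast
  have up: "C \<in> \<U>" if "B \<in> \<U>" "B \<subseteq> C" "C \<subseteq> ?Y" for B C
    using U(1) that unfolding ultrafilter_on_def by blast
  have "{} \<in> decreasing_graphs T r"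
    by (simp add: decreasing_graphs_iff)
  then have x: "point {} \<in> ?Y" by (rule Y)
  have avoid_eq: "avoid e = {g \<in> ?Y. g e = point {} e}" if "e \<in> T \<times> T" for e
    using that by (auto simp: avoid_def point_def)
  have "ultrafilter_converges_in (Y_space T r) \<U> (point {})"
    unfolding ultrafilter_converges_in_def
  proof (intro allI impI)
    fix W assume "neighborhood_in (Y_space T r) (point {}) W"
    then obtain E where E: "finite E" "E \<subseteq> T \<times> T" "{g \<in> ?Y. \<forall>e\<in>E. g e = point {} e} \<subseteq> W" "W \<subseteq> ?Y"
      unfolding neighborhood_in_Y_space[OF x] by blast
    have "?Y \<inter> \<Inter>(avoid ` E) \<in> \<U>"
    proof (rule ultrafilter_on_finite_Inter[OF U(1)])
      show "finite (avoid ` E)"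
        using E(1) by simp
      have "avoid ` E \<subseteq> avoid ` (T \<times> T)"
        using E(2) by (rule image_mono)
      then show "avoid ` E \<subseteq> \<U>"
        using U(2) unfolding \<B>_def Un_subset_iff by (meson subset_trans)
    qed
    moreover have "?Y \<inter> \<Inter>(avoid ` E) \<subseteq> W"
    proof (rule subset_trans[OF _ E(3)], safe)
      fix g e assume "g \<in> \<Inter>(avoid ` E)" "e \<in> E"
      then have "g \<in> avoid e"
        by blast
      then show "g e = point {} e"
        using avoid_eq[OF subsetD[OF E(2) \<open>e \<in> E\<close>]] by simp
    qed
    ultimately show "W \<in> \<U>"
      using E(4) by (rule up)
  qed
  then obtain V where V: "\<And>n. V n \<in> \<U>" "sets_converge_in (Y_space T r) V (point {})"
    using bspec[OF bis[unfolded bisequential_space_def] x] U(1)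
    unfolding bisequential_at_def by metis
  have "\<exists>n. \<forall>m>n. V m \<subseteq> avoid p" if "p \<in> T \<times> T" for p
  proof -
    have "neighborhood_in (Y_space T r) (point {}) (avoid p)"
      unfolding neighborhood_in_Y_space[OF x]
      using that by (intro conjI exI[of _ "{p}"]) (simp_all add: avoid_eq)
    then show ?thesis
      using V(2) unfolding sets_converge_in_def by blast
  qed
  then obtain c where c: "\<And>p m. p \<in> T \<times> T \<Longrightarrow> m > c p \<Longrightarrow> V m \<subseteq> avoid p"
    by metis
  obtain n where n: "fubini_large A {p \<in> A \<times> A. c p \<le> n}"
    using fubini_large_sublevel[OF A] by blast
  let ?P = "{p \<in> A \<times> A. c p \<le> n}"
  have "hit ?P \<in> \<U>"
    using n U(2) by (auto simp: \<B>_def)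
  moreover have "V (Suc n) \<inter> hit ?P = {}"
  proof -
    have "V (Suc n) \<subseteq> avoid p" if "p \<in> ?P" "p \<in> T \<times> T" for p
      using that by (intro c) auto
    then show ?thesis
      unfolding hit_def avoid_def by fastforce
  qed
  ultimately have "{} \<in> \<U>"
    using U(1) V(1)[of "Suc n"] unfolding ultrafilter_on_def by metis
  then show False
    using U(1) unfolding ultrafilter_on_def by blast
qed

theorem theorem4p3:
  fixes T :: "'a set" and r :: "'a rel"
  assumes "tree T r"
  shows "bisequential_space (Y_space T r) \<longleftrightarrow> countable T"
  using assms countable_imp_bisequential uncountable_tree_fubini_selective
    fubini_selective_imp_not_bisequential by metis

end
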